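(* Let $n\ge 0$ be an integer and let $D_{n,5}$ be the weighted tree with vertices $E_0,E_1,\dots,E_n,F_1,\dots,F_5$, where $E_0$ has weight $3$, all other vertices have weight $2$, and the edges are those of the chain $E_n - E_{n-1} - \cdots - E_1 - E_0 - F_1 - F_2 - F_3 - F_4$ together with one edge joining $F_5$ and $F_2$. Then the number of elements of the triple root system $R(D_{n,5})$ is $n^2+33n+72$.
   Context: For a finite weighted tree $\Gamma$ with vertices $V_i$ of weights $w_i$, the intersection form on $\bigoplus_i\mathbb{Z}V_i$ is the symmetric bilinear form with $(V_i\cdot V_i)=-w_i$ and, for $i\neq j$, $(V_i\cdot V_j)=1$ if $V_i$ and $V_j$ are joined by an edge and $0$ otherwise. A non-zero element $\sum m_iV_i$ is a positive (resp. negative) divisor if all $m_i\ge 0$ (resp. all $m_i\le 0$). The triple root system $R(\Gamma)$ is the set of all positive and negative divisors $Y$ with $(Y\cdot Y)=-2$ or $(Y\cdot Y)=-3$. *)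

theory Defs
  imports "HOL-Library.Poly_Mapping"
begin

text \<open>Edges are undirected: the edge joining \<open>u\<close> and \<open>v\<close> is the set \<open>{u, v}\<close>. The value of
  \<open>weight\<close> outside \<open>verts\<close> is irrelevant.\<close>

record 'v weighted_graph =
  verts :: "'v set"
  edges :: "'v set set"
  weight :: "'v \<Rightarrow> int"

definition connected_graph :: "'v weighted_graph \<Rightarrow> bool" where
  "connected_graph G \<longleftrightarrow>
     verts G \<noteq> {} \<and> (\<forall>u\<in>verts G. \<forall>v\<in>verts G. (\<lambda>x y. {x, y} \<in> edges G)\<^sup>*\<^sup>* u v)"

definition graph_cycle :: "'v weighted_graph \<Rightarrow> 'v list \<Rightarrow> bool" where
  "graph_cycle G c \<longleftrightarrow> 3 \<le> length c \<and> distinct c \<and>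
     (\<forall>i<length c. {c ! i, c ! (Suc i mod length c)} \<in> edges G)"

definition finite_weighted_tree :: "'v weighted_graph \<Rightarrow> bool" where
  "finite_weighted_tree G \<longleftrightarrow> finite (verts G) \<and>
     (\<forall>e\<in>edges G. \<exists>u\<in>verts G. \<exists>v\<in>verts G. u \<noteq> v \<and> e = {u, v}) \<and>
     connected_graph G \<and> (\<nexists>c. graph_cycle G c)"

text \<open>The direct sum of copies of the integers indexed by the vertices.\<close>

definition vertex_lattice :: "'v weighted_graph \<Rightarrow> ('v \<Rightarrow>\<^sub>0 int) set" where
  "vertex_lattice G = {Y. Poly_Mapping.keys Y \<subseteq> verts G}"

definition vertex_form :: "'v weighted_graph \<Rightarrow> 'v \<Rightarrow> 'v \<Rightarrow> int" where
  "vertex_form G u v = (if u = v then - weight G u else if {u, v} \<in> edges G then 1 else 0)"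

definition intersection_form ::
    "'v weighted_graph \<Rightarrow> ('v \<Rightarrow>\<^sub>0 int) \<Rightarrow> ('v \<Rightarrow>\<^sub>0 int) \<Rightarrow> int" where
  "intersection_form G Y Z = (\<Sum>u\<in>verts G. \<Sum>v\<in>verts G.
     Poly_Mapping.lookup Y u * Poly_Mapping.lookup Z v * vertex_form G u v)"

definition positive_divisor :: "'v weighted_graph \<Rightarrow> ('v \<Rightarrow>\<^sub>0 int) \<Rightarrow> bool" where
  "positive_divisor G Y \<longleftrightarrow>
     Y \<in> vertex_lattice G \<and> Y \<noteq> 0 \<and> (\<forall>v\<in>verts G. 0 \<le> Poly_Mapping.lookup Y v)"

definition negative_divisor :: "'v weighted_graph \<Rightarrow> ('v \<Rightarrow>\<^sub>0 int) \<Rightarrow> bool" where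
  "negative_divisor G Y \<longleftrightarrow>
     Y \<in> vertex_lattice G \<and> Y \<noteq> 0 \<and> (\<forall>v\<in>verts G. Poly_Mapping.lookup Y v \<le> 0)"

definition triple_root_system :: "'v weighted_graph \<Rightarrow> ('v \<Rightarrow>\<^sub>0 int) set" where
  "triple_root_system G = {Y. (positive_divisor G Y \<or> negative_divisor G Y) \<and>
     (intersection_form G Y Y = -2 \<or> intersection_form G Y Y = -3)}"

datatype vertex = E nat | F nat

definition D5_graph :: "nat \<Rightarrow> vertex weighted_graph" where
  "D5_graph n = \<lparr>
     verts = E ` {0..n} \<union> F ` {1..5},
     edges = {{E (Suc i), E i} | i. i < n} \<union>
       {{E 0, F 1}, {F 1, F 2}, {F 2, F 3}, {F 3, F 4}, {F 5, F 2}},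
     weight = (\<lambda>v. if v = E 0 then 3 else 2)\<rparr>"

lemma finite_weighted_treeI_parent:
  fixes d :: "'v \<Rightarrow> nat"
  assumes fin: "finite (verts G)" and root: "r \<in> verts G"
    and edge: "\<And>x y. {x, y} \<in> edges G \<longleftrightarrow>
      (x \<in> verts G - {r} \<and> y = p x) \<or> (y \<in> verts G - {r} \<and> x = p y)"
    and edge_pair: "\<And>e. e \<in> edges G \<Longrightarrow> \<exists>x y. e = {x, y}"
    and parent: "\<And>x. x \<in> verts G - {r} \<Longrightarrow> p x \<in> verts G \<and> d (p x) < d x"
  shows "finite_weighted_tree G"
proof -
  let ?R = "\<lambda>x y. {x, y} \<in> edges G"
  have sym: "?R x y \<Longrightarrow> ?R y x" for x y by (simp add: insert_commute)
  have to_root: "?R\<^sup>*\<^sup>* x r" if "x \<in> verts G" for x using that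
  proof (induction "d x" arbitrary: x rule: less_induct)
    case less
    show ?case
    proof (cases "x = r")
      case False
      with less.prems have x: "x \<in> verts G - {r}" by simp
      then have "?R x (p x)" using edge by blast
      with less.hyps[of "p x"] parent[OF x] show ?thesis
        by (meson converse_rtranclp_into_rtranclp)
    qed simp
  qed
  have from_root: "?R\<^sup>*\<^sup>* r x" if "x \<in> verts G" for x
    using to_root[OF that]
    by (induction rule: converse_rtranclp_induct) (auto intro: rtranclp.rtrancl_into_rtrancl dest: sym)
  have conn: "connected_graph G"
    unfolding connected_graph_def using root to_root from_root by (blast intro: rtranclp_trans)
  have simple: "\<exists>u\<in>verts G. \<exists>v\<in>verts G. u \<noteq> v \<and> e = {u, v}" if e: "e \<in> edges G" for e
  proof -
    from edge_pair[OF e] obtain x y where xy: "e = {x, y}" by blast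
    with e edge[of x y] consider "x \<in> verts G - {r}" "y = p x" | "y \<in> verts G - {r}" "x = p y"
      by blast
    then show ?thesis
    proof cases
      case 1 with parent[of x] xy show ?thesis by (metis DiffD1 less_irrefl)
    next
      case 2 with parent[of y] xy show ?thesis by (metis DiffD1 less_irrefl)
    qed
  qed
  have acyclic: "\<not> graph_cycle G c" for c
  proof
    assume c: "graph_cycle G c"
    let ?l = "length c"
    have l: "3 \<le> ?l" and dist: "distinct c"
      and step: "\<And>i. i < ?l \<Longrightarrow> {c ! i, c ! (Suc i mod ?l)} \<in> edges G"
      using c by (auto simp: graph_cycle_def)
    let ?D = "(\<lambda>i. d (c ! i)) ` {..<?l}"
    have "0 < ?l" using l by linarith
    then have "0 \<in> {..<?l}" by (rule lessThan_iff[THEN iffD2])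
    then have "?D \<noteq> {}" by blast
    then have "Max ?D \<in> ?D" by (intro Max_in) simp_all
    then obtain i where i: "i < ?l" and im: "d (c ! i) = Max ?D" by auto
    have max: "d (c ! j) \<le> d (c ! i)" if "j < ?l" for j
      unfolding im using that by (intro Max_ge) auto
    define s where "s = Suc i mod ?l"
    define t where "t = (if i = 0 then ?l - 1 else i - 1)"
    have s: "s < ?l" using l by (auto simp: s_def intro: mod_less_divisor)
    have t: "t < ?l" and ti: "Suc t mod ?l = i" using l i by (auto simp: t_def)
    have "s \<noteq> t" using l i by (auto simp: s_def t_def mod_if split: if_splits)
    have 1: "c ! s = p (c ! i)" using step[OF i] edge[of "c ! i" "c ! s"] parent[of "c ! s"] max[OF s]
      unfolding s_def[symmetric] by auto
    have 2: "c ! t = p (c ! i)" using step[OF t] edge[of "c ! t" "c ! i"] parent[of "c ! t"] max[OF t]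
      unfolding ti by auto
    from 1 2 have "c ! s = c ! t" by simp
    with \<open>s \<noteq> t\<close> dist s t show False by (simp add: nth_eq_iff_index_eq)
  qed
  from fin simple conn acyclic show ?thesis by (auto simp: finite_weighted_tree_def)
qed

lemma F_image: "F ` {1..5} = {F 1, F 2, F 3, F 4, F 5}"
  by (force simp: image_iff)

lemma finite_weighted_tree_D5_graph: "finite_weighted_tree (D5_graph n)"
proof (rule finite_weighted_treeI_parent[where r = "E 0"
    and p = "\<lambda>v. case v of E i \<Rightarrow> E (i - 1)
      | F j \<Rightarrow> if j = 1 then E 0 else if j = 5 then F 2 else F (j - 1)"
    and d = "\<lambda>v. case v of E i \<Rightarrow> i | F j \<Rightarrow> Suc j"])
  fix x y
  show "{x, y} \<in> edges (D5_graph n) \<longleftrightarrow>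
      (x \<in> verts (D5_graph n) - {E 0} \<and> y = (case x of E i \<Rightarrow> E (i - 1)
        | F j \<Rightarrow> if j = 1 then E 0 else if j = 5 then F 2 else F (j - 1))) \<or>
      (y \<in> verts (D5_graph n) - {E 0} \<and> x = (case y of E i \<Rightarrow> E (i - 1)
        | F j \<Rightarrow> if j = 1 then E 0 else if j = 5 then F 2 else F (j - 1)))"
    unfolding D5_graph_def weighted_graph.simps F_image
    by (cases x; cases y) (auto simp: doubleton_eq_iff image_iff gr0_conv_Suc)
next
  fix x assume "x \<in> verts (D5_graph n) - {E 0}"
  then show "(case x of E i \<Rightarrow> E (i - 1)
      | F j \<Rightarrow> if j = 1 then E 0 else if j = 5 then F 2 else F (j - 1)) \<in> verts (D5_graph n) \<and>
    (case case x of E i \<Rightarrow> E (i - 1)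
      | F j \<Rightarrow> if j = 1 then E 0 else if j = 5 then F 2 else F (j - 1) of E i \<Rightarrow> i | F j \<Rightarrow> Suc j)
    < (case x of E i \<Rightarrow> i | F j \<Rightarrow> Suc j)"
    unfolding D5_graph_def weighted_graph.simps F_image by auto
qed (auto simp: D5_graph_def)

end

theory Submission
  imports Defs
begin

text \<open>Let \<open>e\<^sub>i\<close> and \<open>f\<^sub>j\<close> be the coefficients of \<open>E\<^sub>i\<close> and \<open>F\<^sub>j\<close> in \<open>Y\<close>, and \<open>a = e\<^sub>0\<close>.
  Completing squares along the chain and writing the \<open>D\<^sub>5\<close> lattice spanned by the \<open>F\<^sub>j\<close> as the
  integer vectors \<open>x\<close> with even coordinate sum turns \<open>- 4 (Y \<cdot> Y)\<close> into
  \<open>3 a\<^sup>2 + 4 (\<Sum> (e\<^sub>i - e\<^bsub>i+1\<^esub>)\<^sup>2 + e\<^sub>n\<^sup>2) + \<Sum> (2 x\<^sub>k \<mp> a)\<^sup>2\<close>, a sum of squares, which is at most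
  \<open>12\<close>. Since the chain term is at least \<open>\<bar>a\<bar>\<close>, this forces \<open>\<bar>a\<bar> \<le> 1\<close>. If \<open>a = 0\<close>, parity leaves the
  \<open>n (n + 1) / 2\<close> positive roots of \<open>A\<^sub>n\<close> and the \<open>20\<close> of \<open>D\<^sub>5\<close>; if \<open>a = 1\<close>, the chain is an initial
  segment \<open>E\<^sub>0 + \<dots> + E\<^sub>k\<close>, combined with one of the \<open>16\<close> weights of a half-spin representation of
  \<open>D\<^sub>5\<close>. Negative divisors double the count.\<close>

section \<open>Chain form and the sequences attaining its small values\<close>

text \<open>The last term is the difference to a value 0 past the end. A chain of weights 2
  contributes one further \<open>(e 0)\<^sup>2\<close>, and the weight 3 of \<open>E 0\<close> yet
  another.\<close>

definition chain_form :: "(nat \<Rightarrow> int) \<Rightarrow> nat \<Rightarrow> int" where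
  "chain_form e n = (\<Sum>i<n. (e i - e (Suc i))\<^sup>2) + (e n)\<^sup>2"

text \<open>\<open>(a, b, c, d, g)\<close> are the coefficients of \<open>F 1, \<dots>, F 5\<close>; the squares come from the embedding
  \<open>F\<^sub>4 = x\<^sub>1 - x\<^sub>2\<close>, \<open>F\<^sub>3 = x\<^sub>2 - x\<^sub>3\<close>, \<open>F\<^sub>2 = x\<^sub>3 - x\<^sub>4\<close>, \<open>F\<^sub>1 = x\<^sub>4 - x\<^sub>5\<close>, \<open>F\<^sub>5 = x\<^sub>4 + x\<^sub>5\<close> in
  an orthonormal basis.\<close>

fun d5_form :: "int \<times> int \<times> int \<times> int \<times> int \<Rightarrow> int" where
  "d5_form (a, b, c, d, g) =
     d\<^sup>2 + (c - d)\<^sup>2 + (b - c)\<^sup>2 + (a + g - b)\<^sup>2 + (g - a)\<^sup>2"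

fun nonneg5 :: "int \<times> int \<times> int \<times> int \<times> int \<Rightarrow> bool" where
  "nonneg5 (a, b, c, d, g) \<longleftrightarrow> 0 \<le> a \<and> 0 \<le> b \<and> 0 \<le> c \<and> 0 \<le> d \<and> 0 \<le> g"

definition d5_part :: "(vertex \<Rightarrow>\<^sub>0 int) \<Rightarrow> int \<times> int \<times> int \<times> int \<times> int" where
  "d5_part Y = (Poly_Mapping.lookup Y (F 1), Poly_Mapping.lookup Y (F 2), Poly_Mapping.lookup Y (F 3), Poly_Mapping.lookup Y (F 4), Poly_Mapping.lookup Y (F 5))"

lemma chain_form_Suc_shift: "chain_form e (Suc n) = (e 0 - e 1)\<^sup>2 + chain_form (\<lambda>i. e (Suc i)) n"
  by (simp add: chain_form_def sum.lessThan_Suc_shift del: sum.lessThan_Suc)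

lemma chain_form_nonneg: "0 \<le> chain_form e n"
  by (simp add: chain_form_def sum_nonneg)

text \<open>The differences, with 0 appended to the sequence, telescope to \<open>e 0\<close>, and
  \<open>\<bar>x\<bar> \<le> x\<^sup>2\<close> for integers.\<close>

lemma chain_form_ge: "\<bar>e 0\<bar> \<le> chain_form e n"
proof (induction n arbitrary: e)
  case 0
  then show ?case using self_le_power[of "\<bar>e 0\<bar>" 2] by (cases "e 0 = 0") (auto simp: chain_form_def)
next
  case (Suc n)
  have "\<bar>e 0 - e 1\<bar> \<le> (e 0 - e 1)\<^sup>2"
    using self_le_power[of "\<bar>e 0 - e 1\<bar>" 2] by (cases "e 0 = e 1") auto
  with Suc[of "\<lambda>i. e (Suc i)"] show ?case by (simp add: chain_form_Suc_shift)
qed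

text \<open>A square has the parity of its base, and the bases telescope to
  \<open>e 0\<close>.\<close>

lemma even_chain_form: "even (chain_form e n) \<longleftrightarrow> even (e 0)"
  by (induction n arbitrary: e) (auto simp: chain_form_Suc_shift chain_form_def[of _ 0])

lemma chain_form_eq_0: "chain_form e n = 0 \<Longrightarrow> i \<le> n \<Longrightarrow> e i = 0"
proof (induction n arbitrary: e i)
  case (Suc n)
  from Suc.prems chain_form_nonneg[of "\<lambda>i. e (Suc i)" n] zero_le_power2[of "e 0 - e 1"]
  have "chain_form (\<lambda>i. e (Suc i)) n = 0" "(e 0 - e 1)\<^sup>2 = 0"
    unfolding chain_form_Suc_shift by linarith+
  with Suc.IH[of "\<lambda>i. e (Suc i)"] Suc.prems show ?case by (cases i) auto
qed (simp add: chain_form_def)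

text \<open>Descending from 1 to the appended 0 at total cost 1 leaves room for exactly one unit
  step.\<close>

lemma chain_form_eq_1:
  assumes "chain_form e n = 1" "e 0 = 1"
  shows "\<exists>k\<le>n. \<forall>i\<le>n. e i = of_bool (i \<le> k)"
  using assms
proof (induction n arbitrary: e)
  case (Suc n)
  show ?case
  proof (cases "e 1 = 1")
    case True
    with Suc.prems Suc.IH[of "\<lambda>i. e (Suc i)"] obtain k where
      k: "k \<le> n" "\<And>i. i \<le> n \<Longrightarrow> e (Suc i) = of_bool (i \<le> k)"
      by (auto simp: chain_form_Suc_shift)
    have "e i = of_bool (i \<le> Suc k)" if "i \<le> Suc n" for i
      using that k Suc.prems by (cases i) auto
    with k show ?thesis by (metis Suc_le_mono)
  next
    case False
    then have "0 < (e 0 - e 1)\<^sup>2" using Suc.prems by simp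
    with Suc.prems chain_form_nonneg[of "\<lambda>i. e (Suc i)" n] have "chain_form (\<lambda>i. e (Suc i)) n = 0"
      unfolding chain_form_Suc_shift by linarith
    then have z: "e (Suc i) = 0" if "i \<le> n" for i using chain_form_eq_0 that by fastforce
    have "e i = of_bool (i \<le> 0)" if "i \<le> Suc n" for i
      using that z Suc.prems by (cases i) auto
    then show ?thesis by blast
  qed
qed simp

text \<open>The sequence starts at 0 and ends at the appended 0, so cost 2 means one unit step up
  and one down; nonnegativity puts the step up first.\<close>

lemma chain_form_eq_2:
  assumes "chain_form e n = 2" "e 0 = 0" "\<And>i. i \<le> n \<Longrightarrow> 0 \<le> e i"
  shows "\<exists>j k. 1 \<le> j \<and> j \<le> k \<and> k \<le> n \<and> (\<forall>i\<le>n. e i = of_bool (j \<le> i \<and> i \<le> k))"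
  using assms
proof (induction n arbitrary: e)
  case (Suc n)
  have sq: "(e 1)\<^sup>2 + chain_form (\<lambda>i. e (Suc i)) n = 2"
    using Suc.prems by (simp add: chain_form_Suc_shift)
  have "e 1 < 2"
    using sq chain_form_nonneg[of "\<lambda>i. e (Suc i)" n] power_mono[of 2 "e 1" 2] by fastforce
  moreover have "0 \<le> e 1" using Suc.prems(3)[of 1] by simp
  ultimately consider "e 1 = 0" | "e 1 = 1" by linarith
  then show ?case
  proof cases
    case 1
    with sq Suc.prems Suc.IH[of "\<lambda>i. e (Suc i)"] obtain j k where
      jk: "1 \<le> j" "j \<le> k" "k \<le> n" "\<And>i. i \<le> n \<Longrightarrow> e (Suc i) = of_bool (j \<le> i \<and> i \<le> k)"
      by auto
    have "e i = of_bool (Suc j \<le> i \<and> i \<le> Suc k)" if "i \<le> Suc n" for i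
      using that jk Suc.prems by (cases i) auto
    with jk show ?thesis by (intro exI[of _ "Suc j"] exI[of _ "Suc k"]) auto
  next
    case 2
    with sq chain_form_eq_1[of "\<lambda>i. e (Suc i)" n] obtain k where
      k: "k \<le> n" "\<And>i. i \<le> n \<Longrightarrow> e (Suc i) = of_bool (i \<le> k)"
      by auto
    have "e i = of_bool (Suc 0 \<le> i \<and> i \<le> Suc k)" if "i \<le> Suc n" for i
      using that k Suc.prems by (cases i) auto
    with k show ?thesis by (intro exI[of _ "Suc 0"] exI[of _ "Suc k"]) auto
  qed
qed (simp add: chain_form_def)

lemma chain_form_zero: "chain_form (\<lambda>_. 0) n = 0"
  by (simp add: chain_form_def)

lemma chain_form_initial: "k \<le> n \<Longrightarrow> chain_form (\<lambda>i. of_bool (i \<le> k)) n = 1"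
proof (induction n arbitrary: k)
  case (Suc n)
  then show ?case
    by (cases k) (auto simp: chain_form_Suc_shift chain_form_zero)
qed (simp add: chain_form_def)

lemma chain_form_interval:
  "1 \<le> j \<Longrightarrow> j \<le> k \<Longrightarrow> k \<le> n \<Longrightarrow> chain_form (\<lambda>i. of_bool (j \<le> i \<and> i \<le> k)) n = 2"
proof (induction n arbitrary: j k)
  case (Suc n)
  obtain k' where k': "k = Suc k'" using Suc.prems by (cases k) auto
  obtain j' where j': "j = Suc j'" using Suc.prems by (cases j) auto
  show ?case
    using Suc k' j' chain_form_initial[of k' n]
    by (cases "j' = 0") (auto simp: chain_form_Suc_shift)
qed simp

section \<open>Intersection form of the graph\<close>

lemma verts_D5_graph_Suc: "verts (D5_graph (Suc n)) = insert (E (Suc n)) (verts (D5_graph n))"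
  by (auto simp: D5_graph_def atLeastAtMostSuc_conv)

lemma finite_verts_D5_graph: "finite (verts (D5_graph n))"
  by (simp add: D5_graph_def)

lemma vertex_form_D5_graph_Suc:
  assumes "u \<in> verts (D5_graph n)" "v \<in> verts (D5_graph n)"
  shows "vertex_form (D5_graph (Suc n)) u v = vertex_form (D5_graph n) u v"
  using assms unfolding vertex_form_def D5_graph_def weighted_graph.simps F_image
  by (cases u; cases v) (auto simp: doubleton_eq_iff less_Suc_eq)

lemma vertex_form_D5_graph_new:
  assumes "v \<in> verts (D5_graph n)"
  shows "vertex_form (D5_graph (Suc n)) (E (Suc n)) v = of_bool (v = E n)"
    and "vertex_form (D5_graph (Suc n)) v (E (Suc n)) = of_bool (v = E n)"
  using assms unfolding vertex_form_def D5_graph_def weighted_graph.simps F_image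
  by (cases v; auto simp: doubleton_eq_iff)+

text \<open>Induction on \<open>n\<close>: attaching the leaf \<open>E (Suc n)\<close> to
  \<open>E n\<close> changes both sides equally. The last term is the edge between
  \<open>E 0\<close> and \<open>F 1\<close>.\<close>

lemma intersection_form_D5_graph:
  "- intersection_form (D5_graph n) Y Y =
     2 * (Poly_Mapping.lookup Y (E 0))\<^sup>2 + chain_form (\<lambda>i. Poly_Mapping.lookup Y (E i)) n + d5_form (d5_part Y)
     - 2 * Poly_Mapping.lookup Y (E 0) * Poly_Mapping.lookup Y (F 1)"
proof (induction n)
  case 0
  have v: "verts (D5_graph 0) = {E 0, F 1, F 2, F 3, F 4, F 5}"
    by (auto simp: D5_graph_def F_image)
  show ?case
    unfolding intersection_form_def v
    by (simp add: vertex_form_def D5_graph_def doubleton_eq_iff chain_form_def d5_part_def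
        power2_eq_square algebra_simps)
next
  case (Suc n)
  let ?V = "verts (D5_graph n)" and ?y = "Poly_Mapping.lookup Y" and ?b = "vertex_form (D5_graph (Suc n))"
  have new: "E (Suc n) \<notin> ?V" and last: "E n \<in> ?V" by (auto simp: D5_graph_def)
  have old: "(\<Sum>u\<in>?V. \<Sum>v\<in>?V. ?y u * ?y v * ?b u v) = intersection_form (D5_graph n) Y Y"
    unfolding intersection_form_def by (intro sum.cong refl) (simp add: vertex_form_D5_graph_Suc)
  have 1: "(\<Sum>v\<in>?V. ?y (E (Suc n)) * ?y v * ?b (E (Suc n)) v) = ?y (E (Suc n)) * ?y (E n)"
  proof -
    have "(\<Sum>v\<in>?V. ?y (E (Suc n)) * ?y v * ?b (E (Suc n)) v) =
        (\<Sum>v\<in>?V. if v = E n then ?y (E (Suc n)) * ?y v else 0)"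
      by (intro sum.cong refl) (simp add: vertex_form_D5_graph_new)
    with last show ?thesis by (simp add: finite_verts_D5_graph)
  qed
  have 2: "(\<Sum>v\<in>?V. ?y v * ?y (E (Suc n)) * ?b v (E (Suc n))) = ?y (E (Suc n)) * ?y (E n)"
  proof -
    have "(\<Sum>v\<in>?V. ?y v * ?y (E (Suc n)) * ?b v (E (Suc n))) =
        (\<Sum>v\<in>?V. if v = E n then ?y (E (Suc n)) * ?y v else 0)"
      by (intro sum.cong refl) (simp add: vertex_form_D5_graph_new)
    with last show ?thesis by (simp add: finite_verts_D5_graph)
  qed
  have 3: "?b (E (Suc n)) (E (Suc n)) = - 2" by (simp add: vertex_form_def D5_graph_def)
  have "intersection_form (D5_graph (Suc n)) Y Y =
      intersection_form (D5_graph n) Y Y + 2 * ?y (E (Suc n)) * ?y (E n) - 2 * (?y (E (Suc n)))\<^sup>2"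
    unfolding intersection_form_def[of "D5_graph (Suc n)"] verts_D5_graph_Suc
    using new by (simp add: finite_verts_D5_graph sum.distrib old 1 2 3 power2_eq_square)
  moreover have "chain_form (\<lambda>i. ?y (E i)) (Suc n) = chain_form (\<lambda>i. ?y (E i)) n
      + 2 * (?y (E (Suc n)))\<^sup>2 - 2 * ?y (E (Suc n)) * ?y (E n)"
    by (simp add: chain_form_def power2_eq_square algebra_simps)
  ultimately show ?case using Suc by linarith
qed

section \<open>Short vectors of the D5 lattice\<close>

definition d5_roots :: "(int \<times> int \<times> int \<times> int \<times> int) set" where
  "d5_roots = {f. nonneg5 f \<and> d5_form f = 2}"

text \<open>If \<open>\<lambda>\<close> is the fundamental weight dual to \<open>F\<^sub>1\<close>, then \<open>d5_form f = 2 * fst f\<close> says that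
  \<open>\<lambda> - f\<close> is as long as \<open>\<lambda>\<close>, so that \<open>\<lambda> - f\<close> runs over the orbit of \<open>\<lambda>\<close> under the Weyl group.\<close>

definition d5_spin :: "(int \<times> int \<times> int \<times> int \<times> int) set" where
  "d5_spin = {f. nonneg5 f \<and> d5_form f = 2 * fst f}"

definition d5_box :: "(int \<times> int \<times> int \<times> int \<times> int) list" where
  "d5_box = List.product [0..2] (List.product [0..3] (List.product [0..2] (List.product [0..1] [0..2])))"

lemma square_le_3_int: "x\<^sup>2 \<le> 3 \<Longrightarrow> \<bar>x\<bar> \<le> 1" for x :: int
proof (rule ccontr)
  assume "x\<^sup>2 \<le> 3" "\<not> \<bar>x\<bar> \<le> 1"
  then show False using power_mono[of 2 "\<bar>x\<bar>" 2] by simp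
qed

text \<open>The five squared coordinates have bases adding up to \<open>2 * g\<close>.\<close>

lemma even_d5_form: "even (d5_form f)"
  by (cases f) auto

lemma d5_form_nonneg: "0 \<le> d5_form f"
  by (cases f) simp

lemma d5_form_eq_0: "d5_form f = 0 \<longleftrightarrow> f = (0, 0, 0, 0, 0)"
  by (cases f) (auto simp: add_nonneg_eq_0_iff)

lemma mem_d5_box:
  "(a, b, c, d, g) \<in> set d5_box \<longleftrightarrow>
     a \<in> {0..2} \<and> b \<in> {0..3} \<and> c \<in> {0..2} \<and> d \<in> {0..1} \<and> g \<in> {0..2}"
  by (auto simp: d5_box_def)

text \<open>Adding up the bounds gives \<open>d \<le> 1\<close>, \<open>c \<le> 2\<close>,
  \<open>b \<le> 3\<close>, \<open>a + g \<le> 4\<close>; as \<open>a\<close> and \<open>g\<close>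
  differ by at most 1, both are at most 2. This makes both counts finite evaluations.\<close>

lemma d5_box_if:
  assumes "nonneg5 (a, b, c, d, g)" "\<bar>d\<bar> \<le> 1" "\<bar>c - d\<bar> \<le> 1" "\<bar>b - c\<bar> \<le> 1" "\<bar>a + g - b\<bar> \<le> 1"
    "\<bar>g - a\<bar> \<le> 1"
  shows "(a, b, c, d, g) \<in> set d5_box"
  using assms unfolding mem_d5_box by auto

lemma d5_roots_eq: "d5_roots = set (filter (\<lambda>f. d5_form f = 2) d5_box)"
proof -
  have "f \<in> set d5_box" if f: "nonneg5 f" "d5_form f = 2" for f
  proof (cases f)
    case (fields a b c d g)
    have eq: "2 = d\<^sup>2 + (c - d)\<^sup>2 + (b - c)\<^sup>2 + (a + g - b)\<^sup>2 + (g - a)\<^sup>2"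
      using f unfolding fields by simp
    note ge = zero_le_power2[of d] zero_le_power2[of "c - d"] zero_le_power2[of "b - c"]
      zero_le_power2[of "a + g - b"] zero_le_power2[of "g - a"]
    show ?thesis unfolding fields
      using f(1) unfolding fields
      by (rule d5_box_if) (rule square_le_3_int, use eq ge in linarith)+
  qed
  then show ?thesis unfolding d5_roots_def by (auto simp: mem_d5_box)
qed

text \<open>The vector subtracted from \<open>2 x\<close> is \<open>2 t \<lambda>\<close> with \<open>\<lambda> = (1, 1, 1, 1, -1) / 2\<close>.\<close>

lemma d5_form_spin:
  "4 * d5_form (a, b, c, d, g) - 8 * t * a + 5 * t\<^sup>2 = (2 * d - t)\<^sup>2 + (2 * (c - d) - t)\<^sup>2
     + (2 * (b - c) - t)\<^sup>2 + (2 * (a + g - b) - t)\<^sup>2 + (2 * (g - a) + t)\<^sup>2"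
  by (simp add: power2_eq_square algebra_simps)

lemma d5_form_spin_ge: "- 5 * t\<^sup>2 \<le> 4 * d5_form f - 8 * t * fst f"
proof (cases f)
  case (fields a b c d g)
  have "0 \<le> 4 * d5_form (a, b, c, d, g) - 8 * t * a + 5 * t\<^sup>2"
    unfolding d5_form_spin by simp
  then show ?thesis unfolding fields fst_conv by linarith
qed

lemma d5_spin_eq: "d5_spin = set (filter (\<lambda>f. d5_form f = 2 * fst f) d5_box)"
proof -
  have odd_sq: "1 \<le> (2 * x - 1)\<^sup>2" "1 \<le> (2 * x + 1)\<^sup>2" for x :: int
  proof -
    have "1 \<le> \<bar>2 * x - 1\<bar>" "1 \<le> \<bar>2 * x + 1\<bar>" by presburger+
    then show "1 \<le> (2 * x - 1)\<^sup>2" "1 \<le> (2 * x + 1)\<^sup>2"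
      using power_mono[of 1 "\<bar>2 * x - 1\<bar>" 2] power_mono[of 1 "\<bar>2 * x + 1\<bar>" 2]
      unfolding power2_abs power_one by auto
  qed
  have unit: "\<bar>x\<bar> \<le> 1" if "(2 * x - 1)\<^sup>2 \<le> 3 \<or> (2 * x + 1)\<^sup>2 \<le> 3" for x :: int
    using that square_le_3_int[of "2 * x - 1"] square_le_3_int[of "2 * x + 1"] by linarith
  have "f \<in> set d5_box" if f: "nonneg5 f" "d5_form f = 2 * fst f" for f
  proof (cases f)
    case (fields a b c d g)
    \<comment> \<open>Case \<open>t = 1\<close> of \<open>d5_form_spin\<close>: five odd squares
      with sum 5 must all be 1.\<close>
    have eq: "5 = (2 * d - 1)\<^sup>2 + (2 * (c - d) - 1)\<^sup>2
     + (2 * (b - c) - 1)\<^sup>2 + (2 * (a + g - b) - 1)\<^sup>2 + (2 * (g - a) + 1)\<^sup>2"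
      using f d5_form_spin[of a b c d g 1] unfolding fields fst_conv by simp
    note ge = odd_sq(1)[of d] odd_sq(1)[of "c - d"] odd_sq(1)[of "b - c"]
      odd_sq(1)[of "a + g - b"] odd_sq(2)[of "g - a"]
    show ?thesis unfolding fields
      using f(1) unfolding fields
      by (rule d5_box_if) (rule unit, use eq ge in linarith)+
  qed
  then show ?thesis unfolding d5_spin_def by (auto simp: mem_d5_box)
qed

lemma card_d5_roots: "card d5_roots = 20"
  unfolding d5_roots_eq by code_simp

lemma card_d5_spin: "card d5_spin = 16"
  unfolding d5_spin_eq by code_simp

section \<open>Parametrisation and count of the positive roots\<close>

text \<open>Chain coefficients of positive roots turn out to be 0 or 1, so a set of indices records
  them. The final 0 covers labels \<open>F j\<close> outside the graph.\<close>

fun divisor_coeff :: "nat set \<times> int \<times> int \<times> int \<times> int \<times> int \<Rightarrow> vertex \<Rightarrow> int" where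
  "divisor_coeff (S, a, b, c, d, g) (E i) = of_bool (i \<in> S)"
| "divisor_coeff (S, a, b, c, d, g) (F j) =
     (if j = 1 then a else if j = 2 then b else if j = 3 then c else if j = 4 then d
      else if j = 5 then g else 0)"

definition divisor_of :: "nat set \<times> int \<times> int \<times> int \<times> int \<times> int \<Rightarrow> vertex \<Rightarrow>\<^sub>0 int" where
  "divisor_of p = Abs_poly_mapping (divisor_coeff p)"

lemma lookup_divisor_of:
  assumes "finite S"
  shows "Poly_Mapping.lookup (divisor_of (S, f)) = divisor_coeff (S, f)"
proof -
  have "{v. divisor_coeff (S, f) v \<noteq> 0} \<subseteq> E ` S \<union> F ` {1..5}"
  proof
    fix v assume "v \<in> {v. divisor_coeff (S, f) v \<noteq> 0}"
    then show "v \<in> E ` S \<union> F ` {1..5}"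
      unfolding F_image by (cases f; cases v) (auto split: if_splits)
  qed
  then have "finite {v. divisor_coeff (S, f) v \<noteq> 0}"
    by (rule finite_subset) (simp add: assms)
  then show ?thesis unfolding divisor_of_def by (rule lookup_Abs_poly_mapping)
qed

text \<open>Indexing an interval by its upper end \<open>k\<close> leaves \<open>k\<close> lower
  ends, so the first family has \<open>\<Sum>{1..n}\<close> members.\<close>

definition divisor_data :: "nat \<Rightarrow> (nat set \<times> int \<times> int \<times> int \<times> int \<times> int) set" where
  "divisor_data n = (\<lambda>(k, j). ({j..k}, 0, 0, 0, 0, 0)) ` (SIGMA k:{1..n}. {1..k})
     \<union> Pair {} ` d5_roots \<union> (\<lambda>(k, f). ({..k}, f)) ` ({..n} \<times> d5_spin)"

lemma finite_d5_roots: "finite d5_roots" and finite_d5_spin: "finite d5_spin"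
  unfolding d5_roots_eq d5_spin_eq by (rule finite_set)+

lemma divisor_data_finite: "(S, f) \<in> divisor_data n \<Longrightarrow> finite S \<and> S \<subseteq> {..n}"
  by (auto simp: divisor_data_def)

lemma card_divisor_data: "2 * card (divisor_data n) = n * (n + 1) + 40 + 32 * (n + 1)"
proof -
  let ?A = "(\<lambda>(k, j). ({j..k}, 0::int, 0::int, 0::int, 0::int, 0::int)) ` (SIGMA k:{1..n}. {1..k})"
    and ?B = "Pair ({} :: nat set) ` d5_roots" and ?C = "(\<lambda>(k, f). ({..k}, f)) ` ({..n} \<times> d5_spin)"
  have "inj_on (\<lambda>(k, j). ({j..k}, 0::int, 0::int, 0::int, 0::int, 0::int)) (SIGMA k:{1..n}. {1..k})"
    by (auto simp: inj_on_def)
  then have A: "card ?A = \<Sum>{1..n}"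
    by (simp add: card_image)
  have B: "card ?B = 20"
    by (simp add: card_image card_d5_roots inj_on_def)
  have "inj_on (\<lambda>(k, f). ({..k}, f)) ({..n} \<times> d5_spin)"
    by (auto simp: inj_on_def)
  then have C: "card ?C = (n + 1) * 16"
    by (simp add: card_image card_d5_spin card_cartesian_product)
  \<comment> \<open>First components separate the families: 0 lies only in those of
    \<open>?C\<close>, and only those of \<open>?B\<close> are empty.\<close>
  have "(?A \<union> ?B) \<inter> ?C = {}" "?A \<inter> ?B = {}"
  proof -
    have "0 \<notin> fst p" if "p \<in> ?A \<union> ?B" for p using that by auto
    moreover have "0 \<in> fst p" if "p \<in> ?C" for p using that by auto
    ultimately show "(?A \<union> ?B) \<inter> ?C = {}" by blast
    have "fst p \<noteq> {}" if "p \<in> ?A" for p using that by auto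
    moreover have "fst p = {}" if "p \<in> ?B" for p using that by auto
    ultimately show "?A \<inter> ?B = {}" by blast
  qed
  then have "card (divisor_data n) = card ?A + card ?B + card ?C"
    unfolding divisor_data_def by (simp add: card_Un_disjoint finite_d5_roots finite_d5_spin)
  then have "card (divisor_data n) = \<Sum>{1..n} + 20 + (n + 1) * 16"
    unfolding A B C .
  moreover have "2 * \<Sum>{1..n} = n * (n + 1)"
    by (induction n) auto
  ultimately show ?thesis by simp
qed

section \<open>Classification of the values 2 and 3\<close>

definition norm_form :: "nat \<Rightarrow> (nat \<Rightarrow> int) \<Rightarrow> int \<times> int \<times> int \<times> int \<times> int \<Rightarrow> int" where
  "norm_form n e f = 2 * (e 0)\<^sup>2 + chain_form e n + d5_form f - 2 * e 0 * fst f"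

lemma divisor_data_exists:
  assumes e: "\<And>i. i \<le> n \<Longrightarrow> 0 \<le> e i" and f: "nonneg5 f"
    and norm: "norm_form n e f = 2 \<or> norm_form n e f = 3"
  shows "\<exists>S. (S, f) \<in> divisor_data n \<and> (\<forall>i\<le>n. e i = of_bool (i \<in> S))"
proof -
  \<comment> \<open>Four times the norm is at most 12. By \<open>d5_form_spin_ge\<close> at
    \<open>t = e 0\<close>, the terms in \<open>f\<close> cost at most
    \<open>5 * (e 0)\<^sup>2\<close> of the available \<open>8 * (e 0)\<^sup>2\<close>.\<close>
  have bound: "3 * (e 0)\<^sup>2 + 4 * chain_form e n \<le> 12"
    using norm d5_form_spin_ge[of "e 0" f] unfolding norm_form_def by auto
  have "e 0 < 2"
  proof (rule ccontr)
    assume "\<not> e 0 < 2"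
    \<comment> \<open>The left side of \<open>bound\<close> would be at least 3 * 4 + 4 * 2 =
      20.\<close>
    then have "2\<^sup>2 \<le> (e 0)\<^sup>2" by (intro power_mono) auto
    with bound chain_form_ge[of e n] \<open>\<not> e 0 < 2\<close> show False by simp
  qed
  moreover have "0 \<le> e 0" using e[of 0] by simp
  ultimately consider "e 0 = 0" | "e 0 = 1" by linarith
  then show ?thesis
  proof cases
    case 1
    \<comment> \<open>Both forms are even and nonnegative, so their sum is 2 and one of them
      vanishes.\<close>
    have "even (chain_form e n)" "even (d5_form f)"
      using 1 by (simp_all add: even_chain_form even_d5_form)
    with norm 1 chain_form_nonneg[of e n] d5_form_nonneg[of f]
    have "chain_form e n = 2 \<and> d5_form f = 0 \<or> chain_form e n = 0 \<and> d5_form f = 2"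
      unfolding norm_form_def by auto presburger+
    then show ?thesis
    proof
      assume A: "chain_form e n = 2 \<and> d5_form f = 0"
      then obtain j k where jk: "1 \<le> j" "j \<le> k" "k \<le> n"
          "\<forall>i\<le>n. e i = of_bool (j \<le> i \<and> i \<le> k)"
        using chain_form_eq_2[of e n] 1 e by blast
      have "(k, j) \<in> (SIGMA k:{1..n}. {1..k})" using jk by auto
      then have "({j..k}, f) \<in> divisor_data n"
        using A unfolding divisor_data_def d5_form_eq_0 by (auto simp: image_iff)
      with jk show ?thesis by (intro exI[of _ "{j..k}"]) auto
    next
      assume "chain_form e n = 0 \<and> d5_form f = 2"
      then show ?thesis
        using f chain_form_eq_0[of e n]
        by (intro exI[of _ "{}"]) (auto simp: divisor_data_def d5_roots_def)
    qed
  next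
    case 2
    have odd: "odd (chain_form e n)" using 2 by (simp add: even_chain_form)
    from bound 2 have "chain_form e n \<le> 2" by simp
    with odd chain_form_ge[of e n] 2 have chain: "chain_form e n = 1"
      by (cases "chain_form e n = 2") auto
    then obtain k where k: "k \<le> n" "\<forall>i\<le>n. e i = of_bool (i \<le> k)"
      using chain_form_eq_1 2 by blast
    \<comment> \<open>The norm is \<open>3 + (d5_form f - 2 * fst f)\<close> with an even bracket,
      so it cannot be 2.\<close>
    have "d5_form f = 2 * fst f"
      using norm chain 2 even_d5_form[of f] unfolding norm_form_def by auto
    then have "f \<in> d5_spin" using f by (simp add: d5_spin_def)
    with k show ?thesis by (intro exI[of _ "{..k}"]) (auto simp: divisor_data_def)
  qed
qed

text \<open>Converse of \<open>divisor_data_exists\<close>; the last conjunct makes the divisor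
  non-zero.\<close>

lemma norm_form_divisor_data:
  assumes "(S, f) \<in> divisor_data n"
  shows "norm_form n (\<lambda>i. of_bool (i \<in> S)) f \<in> {2, 3} \<and> nonneg5 f
    \<and> (S \<noteq> {} \<or> f \<noteq> (0, 0, 0, 0, 0))"
proof -
  from assms consider
      j k where "1 \<le> j" "j \<le> k" "k \<le> n" "S = {j..k}" "f = (0, 0, 0, 0, 0)"
    | "S = {}" "f \<in> d5_roots"
    | k where "k \<le> n" "S = {..k}" "f \<in> d5_spin"
    unfolding divisor_data_def by auto
  then show ?thesis
    by cases (auto simp: norm_form_def chain_form_interval chain_form_zero chain_form_initial
        d5_roots_def d5_spin_def)
qed

section \<open>Positive roots as divisors\<close>

lemma d5_part_divisor_of: "finite S \<Longrightarrow> d5_part (divisor_of (S, f)) = f"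
  by (cases f) (simp add: d5_part_def lookup_divisor_of)

lemma lookup_divisor_of_E: "finite S \<Longrightarrow> Poly_Mapping.lookup (divisor_of (S, f)) (E i) = of_bool (i \<in> S)"
  by (cases f) (simp add: lookup_divisor_of)

lemma inj_on_divisor_of: "inj_on divisor_of (divisor_data n)"
proof (rule inj_onI)
  fix p q assume "p \<in> divisor_data n" "q \<in> divisor_data n" and eq: "divisor_of p = divisor_of q"
  moreover obtain S f T g where "p = (S, f)" "q = (T, g)" by (meson surj_pair)
  ultimately have p: "p = (S, f)" "finite S" and q: "q = (T, g)" "finite T"
    using divisor_data_finite by blast+
  have "i \<in> S \<longleftrightarrow> i \<in> T" for i
    using lookup_divisor_of_E[OF p(2), of f i] lookup_divisor_of_E[OF q(2), of g i] eq p q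
    by (simp add: of_bool_eq_iff)
  with d5_part_divisor_of[OF p(2), of f] d5_part_divisor_of[OF q(2), of g] eq p q
  show "p = q" by auto
qed

lemma positive_divisor_D5_graph:
  "positive_divisor (D5_graph n) Y \<longleftrightarrow> Poly_Mapping.keys Y \<subseteq> E ` {..n} \<union> F ` {1..5} \<and> Y \<noteq> 0 \<and>
     (\<forall>i\<le>n. 0 \<le> Poly_Mapping.lookup Y (E i)) \<and> nonneg5 (d5_part Y)"
  unfolding positive_divisor_def vertex_lattice_def D5_graph_def F_image
  by (auto simp: d5_part_def atMost_atLeast0)

lemma intersection_form_D5_graph_norm:
  "intersection_form (D5_graph n) Y Y = - norm_form n (\<lambda>i. Poly_Mapping.lookup Y (E i)) (d5_part Y)"
  using intersection_form_D5_graph[of n Y] unfolding norm_form_def by (simp add: d5_part_def)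

lemma positive_roots_D5_graph:
  "{Y. positive_divisor (D5_graph n) Y \<and>
      (intersection_form (D5_graph n) Y Y = -2 \<or> intersection_form (D5_graph n) Y Y = -3)}
    = divisor_of ` divisor_data n" (is "?P = _")
proof (intro Set.equalityI subsetI)
  fix Y assume Y: "Y \<in> ?P"
  then have supp: "Poly_Mapping.keys Y \<subseteq> E ` {..n} \<union> F ` {1..5}"
    and nonneg: "\<And>i. i \<le> n \<Longrightarrow> 0 \<le> Poly_Mapping.lookup Y (E i)" "nonneg5 (d5_part Y)"
    unfolding positive_divisor_D5_graph by auto
  have "norm_form n (\<lambda>i. Poly_Mapping.lookup Y (E i)) (d5_part Y) \<in> {2, 3}"
    using Y by (auto simp: intersection_form_D5_graph_norm)
  with divisor_data_exists[of n "\<lambda>i. Poly_Mapping.lookup Y (E i)" "d5_part Y"] nonneg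
  obtain S where S: "(S, d5_part Y) \<in> divisor_data n"
      "\<And>i. i \<le> n \<Longrightarrow> Poly_Mapping.lookup Y (E i) = of_bool (i \<in> S)" by auto
  have fin: "finite S" "S \<subseteq> {..n}" using divisor_data_finite[OF S(1)] by auto
  \<comment> \<open>Labels that are not vertices must be compared too; both divisors vanish
    there.\<close>
  have zero: "Poly_Mapping.lookup Y v = 0" if "v \<notin> E ` {..n} \<union> F ` {1..5}" for v
    using that supp by (auto simp: in_keys_iff)
  have "Poly_Mapping.lookup Y v = Poly_Mapping.lookup (divisor_of (S, d5_part Y)) v" for v
  proof (cases v)
    case (E i)
    then show ?thesis
      using S(2)[of i] fin zero[of v] by (cases "i \<le> n") (auto simp: lookup_divisor_of_E)
  next
    case (F j)
    then show ?thesis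
      using zero[of v] fin unfolding F_image by (auto simp: d5_part_def lookup_divisor_of)
  qed
  then have "Y = divisor_of (S, d5_part Y)" by (rule poly_mapping_eqI)
  with S(1) show "Y \<in> divisor_of ` divisor_data n" by blast
next
  fix Y assume "Y \<in> divisor_of ` divisor_data n"
  then obtain S f where Y: "Y = divisor_of (S, f)" and Sf: "(S, f) \<in> divisor_data n" by auto
  have fin: "finite S" "S \<subseteq> {..n}" using divisor_data_finite[OF Sf] by auto
  note nf = norm_form_divisor_data[OF Sf]
  have "Y \<noteq> 0"
  proof
    assume "Y = 0"
    then have "i \<notin> S" for i
      using lookup_divisor_of_E[OF fin(1), of f i] Y by simp
    moreover have "f = (0, 0, 0, 0, 0)"
      using d5_part_divisor_of[OF fin(1), of f] Y \<open>Y = 0\<close> by (simp add: d5_part_def)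
    ultimately show False using nf by auto
  qed
  moreover have "Poly_Mapping.keys Y \<subseteq> E ` {..n} \<union> F ` {1..5}"
  proof
    fix v assume "v \<in> Poly_Mapping.keys Y"
    then have "divisor_coeff (S, f) v \<noteq> 0"
      using fin by (simp add: Y in_keys_iff lookup_divisor_of)
    then show "v \<in> E ` {..n} \<union> F ` {1..5}"
      using fin unfolding F_image by (cases f; cases v) (auto split: if_splits)
  qed
  ultimately show "Y \<in> ?P"
    using nf fin
    by (auto simp: positive_divisor_D5_graph intersection_form_D5_graph_norm Y
        lookup_divisor_of_E d5_part_divisor_of)
qed

section \<open>Negative divisors and the total count\<close>

lemma intersection_form_uminus: "intersection_form G (- Y) (- Y) = intersection_form G Y Y"
  by (simp add: intersection_form_def)

lemma negative_divisor_iff: "negative_divisor G Y \<longleftrightarrow> positive_divisor G (- Y)"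
  by (simp add: negative_divisor_def positive_divisor_def vertex_lattice_def subset_iff in_keys_iff)

lemma positive_divisor_not_negative: "positive_divisor G Y \<Longrightarrow> \<not> negative_divisor G Y"
proof
  assume "positive_divisor G Y" "negative_divisor G Y"
  then have "Poly_Mapping.lookup Y v = 0" for v
    unfolding positive_divisor_def negative_divisor_def vertex_lattice_def
    by (cases "v \<in> verts G") (force simp: in_keys_iff)+
  then have "Y = 0" by (intro poly_mapping_eqI) simp
  with \<open>positive_divisor G Y\<close> show False by (simp add: positive_divisor_def)
qed

theorem proposition3p18:
  fixes n :: nat
  shows "card (triple_root_system (D5_graph n)) = n\<^sup>2 + 33 * n + 72"
proof -
  let ?G = "D5_graph n"
  let ?P = "{Y. positive_divisor ?G Y \<and>
      (intersection_form ?G Y Y = -2 \<or> intersection_form ?G Y Y = -3)}"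
  have card_P: "card ?P = card (divisor_data n)"
    unfolding positive_roots_D5_graph by (rule card_image[OF inj_on_divisor_of])
  have "finite (divisor_data n)"
    by (simp add: divisor_data_def finite_d5_roots finite_d5_spin)
  then have fin: "finite ?P" unfolding positive_roots_D5_graph by simp
  have mem: "Y \<in> uminus ` ?P \<longleftrightarrow> - Y \<in> ?P" for Y
    by (metis (no_types, lifting) imageE imageI minus_minus)
  \<comment> \<open>Negation preserves the form and exchanges the signs, so the negative half
    mirrors \<open>?P\<close>.\<close>
  have "triple_root_system ?G = ?P \<union> uminus ` ?P"
    by (rule set_eqI, unfold Un_iff mem)
      (auto simp: triple_root_system_def negative_divisor_iff intersection_form_uminus)
  moreover have "?P \<inter> uminus ` ?P = {}"
    by (auto simp only: mem disjoint_iff mem_Collect_eq negative_divisor_iff[symmetric]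
        dest: positive_divisor_not_negative)
  moreover have "card (uminus ` ?P) = card ?P"
    by (rule card_image) simp
  ultimately have "card (triple_root_system ?G) = 2 * card (divisor_data n)"
    using fin by (simp add: card_Un_disjoint card_P)
  then show ?thesis
    unfolding card_divisor_data by (simp add: power2_eq_square algebra_simps)
qed

end
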